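(* Let $n\ge1$ and $\varepsilon\in\{+,-\}^{n-1}$. For every $k\in[n]$, $$\mathcal R^\bullet_{\varepsilon,k}(\mathbf x;\mathbf y;u,v)=\sum_{\substack{R\subseteq[n]\\ n\in R}}\mathbf y^{R\setminus\{n\}}u^{|R_\varepsilon^+(R)|}v^{|R_\varepsilon^-(R)|}\,\Gamma_k(Q_{\varepsilon,R}).$$
   Context: Here $u,v,y_1,\ldots,y_n$ are indeterminates, $\mathbf x=(x_1,x_2,\ldots)$, and $\mathbf y^A=\prod_{i\in A}y_i$. Greedy records: for $\pi\in S_n$, set $i_0=n$; once $i_j$ is chosen, let $A_j(\pi)$ be the set of $i<i_j$ such that $\pi_i>\pi_{i_j}$ if $\varepsilon_i=+$, and $\pi_i<\pi_{i_j}$ if $\varepsilon_i=-$; stop if it is empty, otherwise $i_{j+1}=\max A_j(\pi)$. $\operatorname{Rec}_\varepsilon(\pi)=\{i_0,\ldots,i_s\}$; $\operatorname{rec}_\varepsilon^{\pm}(\pi)=\#\{1\le j\le s:\varepsilon_{i_j}=\pm\}$. For $R\subseteq[n]$ with $n\in R$, $R_\varepsilon^{\pm}(R)=\{i\in R\cap[n-1]:\varepsilon_i=\pm\}$. Record poset: for $i<n$ let $\rho_R(i)=\min\{r\in R:r>i\}$. $Q_{\varepsilon,R}$ is the poset on $[n]$ that is the transitive closure of the following relations, one for each $i<n$: $i<\rho_R(i)$ if ($\varepsilon_i=+$ and $i\notin R$) or ($\varepsilon_i=-$ and $i\in R$); otherwise $\rho_R(i)<i$. $\mathcal L(Q)$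 is the set of linear extensions of a poset $Q$ on $[n]$, written as words in which $a$ occurs before $b$ whenever $a<_Qb$; $\mathcal L_k(Q)=\{\sigma\in\mathcal L(Q):\sigma_k=n\}$. Quasisymmetric functions: $\operatorname{Des}(\sigma)=\{i:\sigma_i>\sigma_{i+1}\}$. For $S\subseteq[n-1]$, $F_{S,n}(\mathbf x)=\sum x_{a_1}\cdots x_{a_n}$, summed over $1\le a_1\le\cdots\le a_n$ with $a_i<a_{i+1}$ for $i\in S$. For a poset $Q$ on $[n]$, $\Gamma_k(Q)=\sum_{\sigma\in\mathcal L_k(Q)}F_{\operatorname{Des}(\sigma),n}(\mathbf x)$. Finally $$\mathcal R^\bullet_{\varepsilon,k}(\mathbf x;\mathbf y;u,v)=\sum_{\substack{\pi\in S_n\\ \pi_n=k}}\mathbf y^{\operatorname{Rec}_\varepsilon(\pi)\setminus\{n\}}u^{\operatorname{rec}_\varepsilon^+(\pi)}v^{\operatorname{rec}_\varepsilon^-(\pi)}F_{\operatorname{Des}(\pi^{-1}),n}(\mathbf x),$$ with $\pi^{-1}$ in one-line notation. *)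

theory Defs
  imports
    "HOL-Library.Poly_Mapping"
    "HOL-Library.FuncSet"
    "HOL-Library.Function_Algebras"
    "HOL-Combinatorics.Permutations"
begin

text \<open>
  Throughout, \<open>[n]\<close> is \<^term>\<open>{1..n::nat}\<close>. A word \<open>\<sigma>\<^sub>1 \<dots> \<sigma>\<^sub>n\<close> with letters \<open>[n]\<close>, each used once,
  is a function \<open>\<sigma>\<close> with \<^term>\<open>\<sigma> permutes {1..n::nat}\<close>. A sign vector \<open>\<epsilon> \<in> {+,-}\<^sup>n\<^sup>-\<^sup>1\<close> is a
  function on \<^typ>\<open>nat\<close>; only its values at \<open>1, \<dots>, n - 1\<close> are ever used.
\<close>

datatype sign = SPlus | SMinus


subsection \<open>Polynomials in y, u, v and power series in x\<close>

datatype indet = IY nat | IU | IV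

type_synonym ypoly = "(indet \<Rightarrow>\<^sub>0 nat) \<Rightarrow>\<^sub>0 int"

definition indet_poly :: "indet \<Rightarrow> ypoly" where
  "indet_poly z = Poly_Mapping.single (Poly_Mapping.single z 1) 1"

abbreviation Y :: "nat \<Rightarrow> ypoly" where "Y i \<equiv> indet_poly (IY i)"
abbreviation U :: ypoly where "U \<equiv> indet_poly IU"
abbreviation V :: ypoly where "V \<equiv> indet_poly IV"

definition y_monom :: "nat set \<Rightarrow> ypoly" where
  "y_monom A = (\<Prod>i\<in>A. Y i)"

text \<open>
  A formal power series in \<open>x\<^sub>1, x\<^sub>2, \<dots>\<close> is the function sending an exponent vector to its
  coefficient. The pointwise addition of functions is the addition of series; the pointwise
  product is not their product and is not used. Exponent vectors involving the index 0 always get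
  coefficient 0 below.
\<close>

type_synonym 'c xseries = "(nat \<Rightarrow>\<^sub>0 nat) \<Rightarrow> 'c"

definition scale_series :: "'c::times \<Rightarrow> 'c xseries \<Rightarrow> 'c xseries" (infixr "\<cdot>\<^sub>x" 72) where
  "c \<cdot>\<^sub>x f = (\<lambda>m. c * f m)"

definition F_words :: "nat set \<Rightarrow> nat \<Rightarrow> (nat \<Rightarrow> nat) set" where
  "F_words S n = {a \<in> {1..n} \<rightarrow>\<^sub>E {1..}.
     (\<forall>i\<in>{1..<n}. a i \<le> a (i + 1)) \<and> (\<forall>i\<in>S. a i < a (i + 1))}"

definition x_exponent :: "nat \<Rightarrow> (nat \<Rightarrow> nat) \<Rightarrow> (nat \<Rightarrow>\<^sub>0 nat)" where
  "x_exponent n a = (\<Sum>i=1..n. Poly_Mapping.single (a i) 1)"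

text \<open>
  The coefficient of a monomial in the infinite sum defining \<open>F\<^sub>S\<^sub>,\<^sub>n\<close> is the number of summands equal
  to it, which is finite by the lemma that follows.
\<close>

definition fundamental_qsym :: "nat set \<Rightarrow> nat \<Rightarrow> 'c::semiring_1 xseries" where
  "fundamental_qsym S n = (\<lambda>m. of_nat (card {a \<in> F_words S n. x_exponent n a = m}))"

lemma finite_F_words_exponent: "finite {a \<in> F_words S n. x_exponent n a = m}"
proof (rule finite_subset)
  show "{a \<in> F_words S n. x_exponent n a = m} \<subseteq> {1..n} \<rightarrow>\<^sub>E Poly_Mapping.keys m"
  proof
    fix a assume a: "a \<in> {a \<in> F_words S n. x_exponent n a = m}"
    have "a i \<in> Poly_Mapping.keys m" if "i \<in> {1..n}" for i
    proof -
      have "Poly_Mapping.lookup m (a i) = (\<Sum>j=1..n. Poly_Mapping.lookup (Poly_Mapping.single (a j) (1::nat)) (a i))"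
        using a by (auto simp: x_exponent_def lookup_sum)
      also have "\<dots> \<ge> Poly_Mapping.lookup (Poly_Mapping.single (a i) (1::nat)) (a i)"
        using that by (intro member_le_sum) auto
      finally show ?thesis by (simp add: in_keys_iff)
    qed
    then show "a \<in> {1..n} \<rightarrow>\<^sub>E Poly_Mapping.keys m"
      using a by (auto simp: F_words_def PiE_iff)
  qed
qed (auto intro!: finite_PiE)


subsection \<open>Descents and linear extensions\<close>

definition Des :: "nat \<Rightarrow> (nat \<Rightarrow> nat) \<Rightarrow> nat set" where
  "Des n \<sigma> = {i \<in> {1..<n}. \<sigma> i > \<sigma> (i + 1)}"

text \<open>A poset on \<open>[n]\<close> is given by its strict order, as a set of pairs.\<close>

definition linear_extensions :: "nat \<Rightarrow> (nat \<times> nat) set \<Rightarrow> (nat \<Rightarrow> nat) set" where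
  "linear_extensions n Q = {\<sigma>. \<sigma> permutes {1..n} \<and>
     (\<forall>i\<in>{1..n}. \<forall>j\<in>{1..n}. (\<sigma> i, \<sigma> j) \<in> Q \<longrightarrow> i < j)}"

definition linear_extensions_at :: "nat \<Rightarrow> nat \<Rightarrow> (nat \<times> nat) set \<Rightarrow> (nat \<Rightarrow> nat) set" where
  "linear_extensions_at n k Q = {\<sigma> \<in> linear_extensions n Q. \<sigma> k = n}"

definition Gamma_series :: "nat \<Rightarrow> nat \<Rightarrow> (nat \<times> nat) set \<Rightarrow> 'c::semiring_1 xseries" where
  "Gamma_series n k Q = (\<Sum>\<sigma>\<in>linear_extensions_at n k Q. fundamental_qsym (Des n \<sigma>) n)"


subsection \<open>Greedy records\<close>

definition greedy_set :: "(nat \<Rightarrow> sign) \<Rightarrow> (nat \<Rightarrow> nat) \<Rightarrow> nat \<Rightarrow> nat set" where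
  "greedy_set \<epsilon> \<pi> p = {i \<in> {1..<p}. case \<epsilon> i of SPlus \<Rightarrow> \<pi> i > \<pi> p | SMinus \<Rightarrow> \<pi> i < \<pi> p}"

function greedy_from :: "(nat \<Rightarrow> sign) \<Rightarrow> (nat \<Rightarrow> nat) \<Rightarrow> nat \<Rightarrow> nat list" where
  "greedy_from \<epsilon> \<pi> p = p # (if greedy_set \<epsilon> \<pi> p = {} then []
     else greedy_from \<epsilon> \<pi> (Max (greedy_set \<epsilon> \<pi> p)))"
  by pat_completeness auto
termination
proof (relation "measure (\<lambda>(\<epsilon>, \<pi>, p). p)")
  fix \<epsilon> \<pi> p
  assume "greedy_set \<epsilon> \<pi> p \<noteq> {}"
  moreover have "finite (greedy_set \<epsilon> \<pi> p)"
    by (simp add: greedy_set_def)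
  ultimately have "Max (greedy_set \<epsilon> \<pi> p) \<in> greedy_set \<epsilon> \<pi> p"
    by (rule Max_in[rotated])
  then show "((\<epsilon>, \<pi>, Max (greedy_set \<epsilon> \<pi> p)), \<epsilon>, \<pi>, p) \<in> measure (\<lambda>(\<epsilon>, \<pi>, p). p)"
    by (simp add: greedy_set_def)
qed simp

declare greedy_from.simps [simp del]

definition Rec :: "nat \<Rightarrow> (nat \<Rightarrow> sign) \<Rightarrow> (nat \<Rightarrow> nat) \<Rightarrow> nat set" where
  "Rec n \<epsilon> \<pi> = set (greedy_from \<epsilon> \<pi> n)"

text \<open>The tail of the list drops \<open>i\<^sub>0 = n\<close>, whose sign is undefined.\<close>

definition rec_count :: "nat \<Rightarrow> (nat \<Rightarrow> sign) \<Rightarrow> sign \<Rightarrow> (nat \<Rightarrow> nat) \<Rightarrow> nat" where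
  "rec_count n \<epsilon> s \<pi> = length (filter (\<lambda>i. \<epsilon> i = s) (tl (greedy_from \<epsilon> \<pi> n)))"

definition R_bullet :: "nat \<Rightarrow> (nat \<Rightarrow> sign) \<Rightarrow> nat \<Rightarrow> ypoly xseries" where
  "R_bullet n \<epsilon> k = (\<Sum>\<pi> | \<pi> permutes {1..n} \<and> \<pi> n = k.
     (y_monom (Rec n \<epsilon> \<pi> - {n}) * U ^ rec_count n \<epsilon> SPlus \<pi> * V ^ rec_count n \<epsilon> SMinus \<pi>)
       \<cdot>\<^sub>x fundamental_qsym (Des n (inv \<pi>)) n)"


subsection \<open>The record poset\<close>

definition R_sign :: "nat \<Rightarrow> (nat \<Rightarrow> sign) \<Rightarrow> sign \<Rightarrow> nat set \<Rightarrow> nat set" where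
  "R_sign n \<epsilon> s R = {i \<in> R \<inter> {1..n - 1}. \<epsilon> i = s}"

definition next_rec :: "nat set \<Rightarrow> nat \<Rightarrow> nat" where
  "next_rec R i = Min {r \<in> R. r > i}"

definition record_edge :: "(nat \<Rightarrow> sign) \<Rightarrow> nat set \<Rightarrow> nat \<Rightarrow> nat \<times> nat" where
  "record_edge \<epsilon> R i =
     (if (\<epsilon> i = SPlus \<and> i \<notin> R) \<or> (\<epsilon> i = SMinus \<and> i \<in> R)
      then (i, next_rec R i) else (next_rec R i, i))"

definition record_poset :: "nat \<Rightarrow> (nat \<Rightarrow> sign) \<Rightarrow> nat set \<Rightarrow> (nat \<times> nat) set" where
  "record_poset n \<epsilon> R = (record_edge \<epsilon> R ` {1..<n})\<^sup>+"

end

theory Submission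
  imports Defs
begin

text \<open>
  The idea is that the greedy procedure can be run one position at a time. Scanning \<open>p, p - 1, \<dots>, 1\<close>,
  position \<open>i\<close> is recorded exactly when it lies in the greedy set of the last position recorded so
  far, and that position is the smallest record to the right of \<open>i\<close>. Hence a set \<open>R \<subseteq> {1..p}\<close>
  containing \<open>p\<close> is the set of records of \<open>\<pi>\<close> if and only if, at each \<open>i < p\<close>, membership of \<open>i\<close> in \<open>R\<close> agrees with
  membership in the greedy set of \<^term>\<open>next_rec R i\<close> (lemma \<open>greedy_from_eq_iff\<close>).

  Each of these conditions compares \<open>\<pi> i\<close> with \<open>\<pi> (next_rec R i)\<close>, and going through the two signs
  and the two possibilities \<open>i \<in> R\<close>, \<open>i \<notin> R\<close> shows that it is the comparison prescribed by the
  generating relation of the record poset at \<open>i\<close>. So \<open>\<pi>\<close> has record set \<open>R\<close> if and only if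
  \<open>\<pi>\<inverse>\<close> is a linear extension of that poset (lemma \<open>inv_linear_extension_record_poset_iff\<close>).
  The identity is then the defining sum over \<open>\<pi>\<close>, grouped by the record set of \<open>\<pi>\<close>: the monomial
  depends only on this set, and inverting the permutations of one group turns \<open>\<pi> n = k\<close> into
  the letter \<open>n\<close> standing at place \<open>k\<close>.
\<close>

lemma next_rec_greater:
  assumes "finite R" "p \<in> R" "i < p"
  shows "next_rec R i \<in> R" "i < next_rec R i" "next_rec R i \<le> p"
proof -
  have "finite {r \<in> R. r > i}" "p \<in> {r \<in> R. r > i}"
    using assms by auto
  then have "next_rec R i \<in> {r \<in> R. r > i}" "next_rec R i \<le> p"
    unfolding next_rec_def by (metis Min_in empty_iff, metis Min_le)
  then show "next_rec R i \<in> R" "i < next_rec R i" "next_rec R i \<le> p"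
    by auto
qed

lemma next_rec_eqI:
  assumes "finite R" "p \<in> R" "i < p" "\<And>r. r \<in> R \<Longrightarrow> i < r \<Longrightarrow> p \<le> r"
  shows "next_rec R i = p"
  unfolding next_rec_def using assms by (intro Min_eqI) auto

lemma greedy_set_Max:
  assumes "greedy_set \<epsilon> \<pi> p \<noteq> {}"
  shows "Max (greedy_set \<epsilon> \<pi> p) \<in> greedy_set \<epsilon> \<pi> p"
  using assms by (intro Max_in) (auto simp: greedy_set_def)

lemma greedy_from_sorted_bounds:
  "p \<ge> 1 \<Longrightarrow> sorted_wrt (>) (greedy_from \<epsilon> \<pi> p) \<and> hd (greedy_from \<epsilon> \<pi> p) = p
     \<and> greedy_from \<epsilon> \<pi> p \<noteq> [] \<and> set (greedy_from \<epsilon> \<pi> p) \<subseteq> {1..p}"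
proof (induction \<epsilon> \<pi> p rule: greedy_from.induct)
  case (1 \<epsilon> \<pi> p)
  show ?case
  proof (cases "greedy_set \<epsilon> \<pi> p = {}")
    case True
    then show ?thesis using 1 by (simp add: greedy_from.simps[of \<epsilon> \<pi> p])
  next
    case False
    define q where "q = Max (greedy_set \<epsilon> \<pi> p)"
    have q: "1 \<le> q" "q < p"
      using greedy_set_Max[OF False] by (auto simp: q_def greedy_set_def)
    have "sorted_wrt (>) (greedy_from \<epsilon> \<pi> q)" "set (greedy_from \<epsilon> \<pi> q) \<subseteq> {1..q}"
      using 1(1)[OF False] q by (auto simp: q_def)
    moreover have "greedy_from \<epsilon> \<pi> p = p # greedy_from \<epsilon> \<pi> q"
      using False by (simp add: greedy_from.simps[of \<epsilon> \<pi> p] q_def)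
    ultimately show ?thesis
      using q by (fastforce dest: subsetD)
  qed
qed

lemma start_in_greedy_from: "p \<in> set (greedy_from \<epsilon> \<pi> p)"
  by (subst greedy_from.simps) simp

text \<open>
  Between two consecutive records the procedure skips exactly the positions outside the greedy set
  of the larger one, because it moves to the maximum of that set.
\<close>

lemma greedy_from_local_rule:
  assumes "p \<ge> 1" "i \<in> {1..<p}"
  shows "i \<in> set (greedy_from \<epsilon> \<pi> p) \<longleftrightarrow>
    i \<in> greedy_set \<epsilon> \<pi> (next_rec (set (greedy_from \<epsilon> \<pi> p)) i)"
  using assms
proof (induction \<epsilon> \<pi> p rule: greedy_from.induct)
  case (1 \<epsilon> \<pi> p)
  show ?case
  proof (cases "greedy_set \<epsilon> \<pi> p = {}")
    case True
    have G: "set (greedy_from \<epsilon> \<pi> p) = {p}"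
      using True by (simp add: greedy_from.simps[of \<epsilon> \<pi> p])
    have "next_rec {p} i = p"
      using 1 by (intro next_rec_eqI) auto
    then show ?thesis
      using True 1(3) by (simp add: G)
  next
    case False
    define q where "q = Max (greedy_set \<epsilon> \<pi> p)"
    define H where "H = set (greedy_from \<epsilon> \<pi> q)"
    have q_in: "q \<in> greedy_set \<epsilon> \<pi> p"
      using greedy_set_Max[OF False] by (simp add: q_def)
    then have q: "1 \<le> q" "q < p"
      by (auto simp: greedy_set_def)
    have G: "set (greedy_from \<epsilon> \<pi> p) = insert p H"
      using False by (simp add: greedy_from.simps[of \<epsilon> \<pi> p] q_def H_def)
    have H: "finite H" "q \<in> H" "H \<subseteq> {1..q}"
      using greedy_from_sorted_bounds[OF q(1)] start_in_greedy_from[of q]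
      by (auto simp: H_def)
    consider "i < q" | "i = q" | "q < i"
      by linarith
    then show ?thesis
    proof cases
      assume "i < q"
      note m = next_rec_greater[OF H(1,2) \<open>i < q\<close>]
      have "next_rec (insert p H) i = next_rec H i"
      proof (rule next_rec_eqI)
        show "next_rec H i \<le> r" if "r \<in> insert p H" "i < r" for r
          using that next_rec_greater(3)[OF H(1), of r i] m(3) q(2) by auto
      qed (use H m in auto)
      then show ?thesis
        using 1(1)[OF False] \<open>i < q\<close> 1(3) q G by (simp add: q_def H_def)
    next
      assume "i = q"
      then have "next_rec (insert p H) i = p"
        using H q by (intro next_rec_eqI) auto
      then show ?thesis
        using G H q_in \<open>i = q\<close> by simp
    next
      assume "q < i"
      then have "next_rec (insert p H) i = p"
        using H 1(3) by (intro next_rec_eqI) fastforce+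
      moreover have "i \<notin> greedy_set \<epsilon> \<pi> p"
      proof
        assume "i \<in> greedy_set \<epsilon> \<pi> p"
        then have "i \<le> q"
          unfolding q_def by (intro Max_ge) (auto simp: greedy_set_def)
        then show False
          using \<open>q < i\<close> by simp
      qed
      ultimately show ?thesis
        using G H \<open>q < i\<close> 1(3) by auto
    qed
  qed
qed

text \<open>
  The local rule decides membership of \<open>i\<close> from the part of the set above \<open>i\<close> alone, since
  \<^term>\<open>next_rec R i\<close> looks only there. It therefore determines the set from the top down.
\<close>

lemma greedy_from_eq_iff:
  assumes R: "R \<subseteq> {1..p}" "p \<in> R"
  shows "set (greedy_from \<epsilon> \<pi> p) = R \<longleftrightarrow>
    (\<forall>i\<in>{1..<p}. i \<in> R \<longleftrightarrow> i \<in> greedy_set \<epsilon> \<pi> (next_rec R i))"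
    (is "?G = R \<longleftrightarrow> ?rule")
proof
  have p: "p \<ge> 1"
    using R by auto
  show ?rule if "?G = R"
    using greedy_from_local_rule[OF p] that by blast
  assume rule: ?rule
  have G: "?G \<subseteq> {1..p}" "p \<in> ?G"
    using greedy_from_sorted_bounds[OF p] start_in_greedy_from by blast+
  have agree: "i \<in> ?G \<longleftrightarrow> i \<in> R" if "i \<in> {1..p}" for i
    using that
  proof (induction "p - i" arbitrary: i rule: less_induct)
    case less
    show ?case
    proof (cases "i = p")
      case True
      then show ?thesis using G R by simp
    next
      case False
      have "{r \<in> ?G. r > i} = {r \<in> R. r > i}"
        using less G R by (auto simp: subset_iff intro: diff_less_mono2)
      then have "next_rec ?G i = next_rec R i"
        by (simp add: next_rec_def)
      then show ?thesis
        using rule greedy_from_local_rule[OF p, of i \<epsilon> \<pi>] less False by auto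
    qed
  qed
  then show "?G = R"
    using G(1) R(1) by blast
qed

text \<open>
  For \<open>\<epsilon> i = SPlus\<close> the greedy condition is \<open>\<pi> i > \<pi> (next_rec R i)\<close>, so the relation at \<open>i\<close> has to
  put \<open>i\<close> above \<^term>\<open>next_rec R i\<close> precisely for \<open>i \<in> R\<close>; for \<open>\<epsilon> i = SMinus\<close> the directions are exchanged.
  Injectivity makes the failure of either inequality the reverse strict inequality.
\<close>

lemma record_edge_respected_iff:
  assumes \<pi>: "inj_on \<pi> {1..n}" and R: "R \<subseteq> {1..n}" "n \<in> R" and i: "i \<in> {1..<n}"
  shows "\<pi> (fst (record_edge \<epsilon> R i)) < \<pi> (snd (record_edge \<epsilon> R i)) \<longleftrightarrow>
    (i \<in> R \<longleftrightarrow> i \<in> greedy_set \<epsilon> \<pi> (next_rec R i))"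
proof -
  have "finite R"
    using R by (auto intro: finite_subset)
  then have \<rho>: "i < next_rec R i" "next_rec R i \<le> n"
    using next_rec_greater[of R n i] R i by auto
  then have "\<pi> i \<noteq> \<pi> (next_rec R i)"
    using \<pi> i by (auto dest: inj_onD)
  then show ?thesis
    using \<rho> i by (cases "\<epsilon> i") (auto simp: record_edge_def greedy_set_def)
qed

text \<open>
  The place of the letter \<open>a\<close> in the word \<open>\<pi>\<inverse>\<close> is \<open>\<pi> a\<close>, so being a linear extension says that \<open>\<pi>\<close>
  is increasing along the order, and this passes from generating relations to their closure.
\<close>

lemma linear_extensions_trancl_iff:
  assumes \<pi>: "\<pi> permutes {1..n}" and E: "E \<subseteq> {1..n} \<times> {1..n}"
  shows "inv \<pi> \<in> linear_extensions n (E\<^sup>+) \<longleftrightarrow> (\<forall>(a, b)\<in>E. \<pi> a < \<pi> b)"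
proof
  assume lin: "inv \<pi> \<in> linear_extensions n (E\<^sup>+)"
  show "\<forall>(a, b)\<in>E. \<pi> a < \<pi> b"
  proof safe
    fix a b assume ab: "(a, b) \<in> E"
    then have "\<pi> a \<in> {1..n}" "\<pi> b \<in> {1..n}"
      using E permutes_in_image[OF \<pi>] by blast+
    moreover have "(inv \<pi> (\<pi> a), inv \<pi> (\<pi> b)) \<in> E\<^sup>+"
      using ab by (simp add: permutes_inverses[OF \<pi>])
    ultimately show "\<pi> a < \<pi> b"
      using lin by (simp add: linear_extensions_def)
  qed
next
  assume E_increasing: "\<forall>(a, b)\<in>E. \<pi> a < \<pi> b"
  have "\<pi> a < \<pi> b" if "(a, b) \<in> E\<^sup>+" for a b
    using that by (induction rule: trancl.induct) (use E_increasing in \<open>auto intro: less_trans\<close>)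
  from this[of "inv \<pi> i" "inv \<pi> j" for i j]
  show "inv \<pi> \<in> linear_extensions n (E\<^sup>+)"
    using permutes_inv[OF \<pi>] permutes_inverses[OF \<pi>] by (auto simp: linear_extensions_def)
qed

lemma inv_linear_extension_record_poset_iff:
  assumes \<pi>: "\<pi> permutes {1..n}" and R: "R \<subseteq> {1..n}" "n \<in> R"
  shows "inv \<pi> \<in> linear_extensions n (record_poset n \<epsilon> R) \<longleftrightarrow> Rec n \<epsilon> \<pi> = R"
proof -
  have "finite R"
    using R by (auto intro: finite_subset)
  then have "next_rec R i \<in> {1..n}" if "i \<in> {1..<n}" for i
    using next_rec_greater[of R n i] R that by auto
  then have edges: "record_edge \<epsilon> R ` {1..<n} \<subseteq> {1..n} \<times> {1..n}"
    by (simp add: record_edge_def image_subset_iff)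
  have "inv \<pi> \<in> linear_extensions n (record_poset n \<epsilon> R) \<longleftrightarrow>
      (\<forall>i\<in>{1..<n}. \<pi> (fst (record_edge \<epsilon> R i)) < \<pi> (snd (record_edge \<epsilon> R i)))"
    unfolding record_poset_def linear_extensions_trancl_iff[OF \<pi> edges]
    by (simp add: case_prod_beta)
  also have "\<dots> \<longleftrightarrow> Rec n \<epsilon> \<pi> = R"
    using record_edge_respected_iff[OF permutes_inj_on[OF \<pi>] R]
    by (simp add: Rec_def greedy_from_eq_iff[OF R])
  finally show ?thesis .
qed

lemma rec_count_eq_card:
  assumes "n \<ge> 1"
  shows "rec_count n \<epsilon> s \<pi> = card (R_sign n \<epsilon> s (Rec n \<epsilon> \<pi>))"
proof -
  let ?g = "greedy_from \<epsilon> \<pi> n"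
  have g: "sorted_wrt (>) ?g" "hd ?g = n" "?g \<noteq> []" "set ?g \<subseteq> {1..n}"
    using greedy_from_sorted_bounds[OF assms, of \<epsilon> \<pi>] by auto
  then obtain xs where xs: "?g = n # xs"
    by (cases ?g) auto
  \<comment> \<open>Records are listed without repetition, so counting entries of the list counts elements of the set.\<close>
  have "distinct xs"
    using sorted_wrt_rev[of "(<)" xs] g(1) by (simp add: xs strict_sorted_iff)
  then have "rec_count n \<epsilon> s \<pi> = card (set (filter (\<lambda>i. \<epsilon> i = s) xs))"
    unfolding rec_count_def xs by (subst distinct_card) auto
  also have "set (filter (\<lambda>i. \<epsilon> i = s) xs) = R_sign n \<epsilon> s (Rec n \<epsilon> \<pi>)"
    using g(1,4) unfolding R_sign_def Rec_def xs by fastforce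
  finally show ?thesis .
qed

lemma linear_extensions_at_record_poset:
  assumes R: "R \<subseteq> {1..n}" "n \<in> R"
  shows "linear_extensions_at n k (record_poset n \<epsilon> R) =
    inv ` {\<pi>. \<pi> permutes {1..n} \<and> \<pi> n = k \<and> Rec n \<epsilon> \<pi> = R}" (is "?L = inv ` ?P")
proof (intro equalityI subsetI)
  fix \<sigma> assume \<sigma>: "\<sigma> \<in> ?L"
  then have perm: "\<sigma> permutes {1..n}" and at: "\<sigma> k = n"
    by (auto simp: linear_extensions_at_def linear_extensions_def)
  then have "inv \<sigma> n = k"
    using permutes_inverses[OF perm] by metis
  moreover have "Rec n \<epsilon> (inv \<sigma>) = R"
    using inv_linear_extension_record_poset_iff[OF permutes_inv[OF perm] R] \<sigma>
      permutes_inv_inv[OF perm] by (simp add: linear_extensions_at_def)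
  ultimately show "\<sigma> \<in> inv ` ?P"
    using permutes_inv[OF perm] permutes_inv_inv[OF perm]
    by (intro image_eqI[of _ _ "inv \<sigma>"]) auto
next
  fix \<sigma> assume "\<sigma> \<in> inv ` ?P"
  then obtain \<pi> where \<pi>: "\<pi> permutes {1..n}" "\<pi> n = k" "Rec n \<epsilon> \<pi> = R" "\<sigma> = inv \<pi>"
    by auto
  then show "\<sigma> \<in> ?L"
    using inv_linear_extension_record_poset_iff[OF \<pi>(1) R] permutes_inverses(2)[OF \<pi>(1)]
    by (auto simp: linear_extensions_at_def)
qed

lemma Gamma_series_record_poset:
  assumes R: "R \<subseteq> {1..n}" "n \<in> R"
  shows "Gamma_series n k (record_poset n \<epsilon> R) =
    (\<Sum>\<pi> | \<pi> permutes {1..n} \<and> \<pi> n = k \<and> Rec n \<epsilon> \<pi> = R. fundamental_qsym (Des n (inv \<pi>)) n)"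
proof -
  have "inj_on inv {\<pi>. \<pi> permutes {1..n} \<and> \<pi> n = k \<and> Rec n \<epsilon> \<pi> = R}"
    by (rule inj_onI) (metis (mono_tags) mem_Collect_eq permutes_inv_inv)
  then show ?thesis
    by (simp add: Gamma_series_def linear_extensions_at_record_poset[OF R] sum.reindex)
qed

lemma scale_series_sum:
  fixes f :: "'a \<Rightarrow> 'c::semiring_0 xseries"
  shows "c \<cdot>\<^sub>x (\<Sum>a\<in>A. f a) = (\<Sum>a\<in>A. c \<cdot>\<^sub>x f a)"
proof -
  have "c \<cdot>\<^sub>x 0 = (0 :: 'c xseries)"
    by (rule ext) (simp add: scale_series_def)
  moreover have "c \<cdot>\<^sub>x (g + h) = c \<cdot>\<^sub>x g + c \<cdot>\<^sub>x h" for g h :: "'c xseries"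
    by (rule ext) (simp add: scale_series_def distrib_left)
  ultimately show ?thesis
    by (induction A rule: infinite_finite_induct) simp_all
qed

theorem corollary7p6:
  fixes n k :: nat and \<epsilon> :: "nat \<Rightarrow> sign"
  assumes "n \<ge> 1" and "k \<in> {1..n}"
  shows "R_bullet n \<epsilon> k =
    (\<Sum>R | R \<subseteq> {1..n} \<and> n \<in> R.
       (y_monom (R - {n}) * U ^ card (R_sign n \<epsilon> SPlus R) * V ^ card (R_sign n \<epsilon> SMinus R))
         \<cdot>\<^sub>x Gamma_series n k (record_poset n \<epsilon> R))"
proof -
  let ?P = "{\<pi>. \<pi> permutes {1..n} \<and> \<pi> n = k}"
  let ?S = "{R. R \<subseteq> {1..n} \<and> n \<in> R}"
  define w where "w R =
    y_monom (R - {n}) * U ^ card (R_sign n \<epsilon> SPlus R) * V ^ card (R_sign n \<epsilon> SMinus R)" for R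
  define F where "F \<pi> = (fundamental_qsym (Des n (inv \<pi>)) n :: ypoly xseries)" for \<pi>
  have "finite ?P"
    by (rule finite_subset[OF _ finite_permutations[of "{1..n}"]]) auto
  have Rec_in: "Rec n \<epsilon> ` ?P \<subseteq> ?S"
    using greedy_from_sorted_bounds[OF assms(1)] start_in_greedy_from
    by (auto simp: Rec_def subset_iff)
  have "R_bullet n \<epsilon> k = (\<Sum>\<pi>\<in>?P. w (Rec n \<epsilon> \<pi>) \<cdot>\<^sub>x F \<pi>)"
    by (simp add: R_bullet_def w_def F_def rec_count_eq_card[OF assms(1)])
  also have "\<dots> = (\<Sum>R\<in>?S. \<Sum>\<pi> | \<pi> \<in> ?P \<and> Rec n \<epsilon> \<pi> = R. w (Rec n \<epsilon> \<pi>) \<cdot>\<^sub>x F \<pi>)"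
    using \<open>finite ?P\<close> Rec_in by (intro sum.group[symmetric]) auto
  also have "\<dots> = (\<Sum>R\<in>?S. w R \<cdot>\<^sub>x Gamma_series n k (record_poset n \<epsilon> R))"
    by (intro sum.cong refl)
      (auto simp: Gamma_series_record_poset scale_series_sum F_def conj_assoc intro!: sum.cong)
  finally show ?thesis
    by (simp add: w_def)
qed

end
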